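(* Consider the sequence $\{x_k\}$ generated by the Full-Low Evaluation method (described in the context) applied to $\min_{x\in\mathcal F} f(x)$, and assume the following. (i) There is $f_{\mathrm{low}}\in\mathbb R$ with $f(x)\ge f_{\mathrm{low}}$ for all $x\in\mathbb R^n$. (ii) $f$ is continuously differentiable and $\nabla f$ is Lipschitz continuous with constant $L>0$. (iii) There are constants $\kappa\in(0,1]$, $u_p>0$, $U_p>0$, independent of $k$, such that for every iteration $k$ (at which $g_k,p_k$ are computed) $$\frac{(-g_k)^\top q_k^p}{\|q_k^g\|\,\|q_k^p\|}\ge\kappa \quad\text{and}\quad u_p\|q_k^p\|\le\|q_k^g\|\le U_p\|q_k^p\|.$$ (iv) There is a constant $u_g\in(0,\kappa(1-c))$, independent of $k$, such that the approximate gradient $g_k$ computed at $x_k$ satisfies $\|\nabla f(x_k)-g_k\|\le u_g\|q_k^g\|$. Let $\epsilon>0$ and let $K\ge1$ be the first iteration such that $\|q_{K+1}\|=\|P_{\mathcal F}[x_{K+1}-\nabla f(x_{K+1})]-x_{K+1}\|\le\epsilon$ (so that $\|q_k\|>\epsilon$ for all $0\le k\le K$). Then, to achieve $\|q_{K+1}\|\le\epsilon$, the method takes at most $n_{SF}^K$ successful Full-Eval iterations (among the iterations $0,\dots,K$), where $$n_{SF}^K\le\left\lceil L_1\,(f(x_0)-f_{\mathrm{low}})\,\epsilon^{-2}\right\rceil,\qquad L_1=\frac{(u_g+1)^2U_p}{c\,\kappa\,\beta_{\min}},\qquad \beta_{\min}=\min\left\{\bar\beta,\ \frac{2\tau(\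kappa(1-c)-u_g)u_p}{L}\right\}.$$
   Context: Problem: $f:\mathbb R^n\to\mathbb R$ is minimized over the nonempty set $\mathcal F=\{x\in\mathbb R^n: Ax=b,\ \ell\le A_{\mathcal I}x\le u\}$, where $A\in\mathbb R^{m\times n}$ has full row rank (or is empty, $m=0$), $A_{\mathcal I}\in\mathbb R^{m_{\mathcal I}\times n}$, $b\in\mathbb R^m$, and $\ell<u$ have entries in $\mathbb R\cup\{\pm\infty\}$. $\|\cdot\|$ is the Euclidean norm and $P_{\mathcal F}[x]=\operatorname{argmin}_{y\in\mathcal F}\|x-y\|$. Full-Low Evaluation method. Input: $x_0\in\mathcal F$, $\alpha_0>0$, initial iteration type $t_0=$ Full-Eval. Parameters: $c\in(0,1)$, $\bar\beta\in(0,1]$, $\gamma>0$, $\tau\in(0,1)$, $\lambda\ge1$, $\theta\in(0,1)$, and a forcing function $\rho:\mathbb R_{>0}\to\mathbb R_{>0}$. For $k=0,1,2,\dots$, perform an iteration of type $t_k$: Full-Eval iteration: compute a gradient approximation $g_k\in\mathbb R^n$ and a direction $p_k\in\mathbb R^n$, and set $\bar x_k=P_{\mathcal F}[x_k+p_k]$. Starting from $\beta=\bar\beta$, replace $\beta$ by $\tau\beta$ repeatedly until either the decrease condition $f(x_k+\beta(\bar x_k-x_k))\le f(x_k)+c\,\beta\,g_k^\top(\bar x_k-x_k)$ holds or the condition $\beta\ge\gamma\alpha_k$ fails. If, for the final $\beta$, $\beta\ge\gamma\alpha_k$ holds (so the decrease condition holds), the iteration is successful: $\beta_k=\beta$, $x_{k+1}=x_k+\beta_k(\bar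 x_k-x_k)$, $t_{k+1}=$ Full-Eval. Otherwise it is unsuccessful: $x_{k+1}=x_k$, $t_{k+1}=$ Low-Eval. In both cases $\alpha_{k+1}=\alpha_k$. Low-Eval iteration: generate a finite set $D_k$ of nonzero polling directions. If some $d_k\in D_k$ satisfies $x_k+\alpha_kd_k\in\mathcal F$ and $f(x_k+\alpha_kd_k)\le f(x_k)-\rho(\alpha_k)$, the iteration is successful: $x_{k+1}=x_k+\alpha_kd_k$, $\alpha_{k+1}=\lambda\alpha_k$. Otherwise it is unsuccessful: $x_{k+1}=x_k$, $\alpha_{k+1}=\theta\alpha_k$. The type $t_{k+1}\in\{\text{Full-Eval},\text{Low-Eval}\}$ is decided by an arbitrary user-defined condition, required only to eventually return to Full-Eval. Notation: $q_k=P_{\mathcal F}[x_k-\nabla f(x_k)]-x_k$, $q_k^g=P_{\mathcal F}[x_k-g_k]-x_k$, $q_k^p=\bar x_k-x_k=P_{\mathcal F}[x_k+p_k]-x_k$. The quotient in assumption (iii) presupposes $q_k^g\ne0$ and $q_k^p\ne0$. *)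

theory Defs
  imports "HOL-Analysis.Analysis"
begin

text \<open>
  Linear constraints \<open>A x = b\<close>, \<open>l \<le> AI x \<le> u\<close>.  Matrices are given by their rows, indexed by
  \<open>{..<m}\<close> and \<open>{..<mI}\<close> with \<open>m\<close>, \<open>mI\<close> natural numbers, because a matrix over a finite index type
  cannot have zero rows.  Infinite bounds are values of type \<^typ>\<open>ereal\<close>.
\<close>

definition feasible_set ::
  "nat \<Rightarrow> (nat \<Rightarrow> real ^ 'n) \<Rightarrow> (nat \<Rightarrow> real) \<Rightarrow>
   nat \<Rightarrow> (nat \<Rightarrow> real ^ 'n) \<Rightarrow> (nat \<Rightarrow> ereal) \<Rightarrow> (nat \<Rightarrow> ereal) \<Rightarrow> (real ^ 'n) set" where
  "feasible_set m A b mI AI l u =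
     {x. (\<forall>i<m. A i \<bullet> x = b i) \<and>
         (\<forall>i<mI. l i \<le> ereal (AI i \<bullet> x) \<and> ereal (AI i \<bullet> x) \<le> u i)}"

text \<open>As in the library's notion of row rank; it holds for \<open>m = 0\<close>.\<close>

definition full_row_rank :: "nat \<Rightarrow> (nat \<Rightarrow> real ^ 'n) \<Rightarrow> bool" where
  "full_row_rank m A \<longleftrightarrow> dim (A ` {..<m}) = m"

text \<open>
  The displacement \<open>P\<^sub>F[x + v] - x\<close>.  It gives \<open>q\<^sub>k\<close>, \<open>q\<^sub>k\<^sup>g\<close> and \<open>q\<^sub>k\<^sup>p\<close> for \<open>v = - \<nabla>f(x\<^sub>k)\<close>,
  \<open>v = - g\<^sub>k\<close> and \<open>v = p\<^sub>k\<close>, respectively.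
\<close>

definition proj_step :: "(real ^ 'n) set \<Rightarrow> real ^ 'n \<Rightarrow> real ^ 'n \<Rightarrow> real ^ 'n" where
  "proj_step F x v = closest_point F (x + v) - x"

datatype iter_type = Full_Eval | Low_Eval

text \<open>
  The final value of \<open>\<beta>\<close> in the line search of a Full-Eval iteration: the first element of
  \<open>\<beta>bar, \<tau> \<beta>bar, \<tau>\<^sup>2 \<beta>bar, \<dots>\<close> at which the decrease condition holds or \<open>\<beta> \<ge> \<gamma> a\<close> fails.  Such an
  element exists whenever \<open>\<gamma> > 0\<close>, \<open>a > 0\<close> and \<open>0 < \<tau> < 1\<close>.
\<close>

definition full_eval_beta ::
  "(real ^ 'n) set \<Rightarrow> (real ^ 'n \<Rightarrow> real) \<Rightarrow> real \<Rightarrow> real \<Rightarrow> real \<Rightarrow> real \<Rightarrow>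
   real ^ 'n \<Rightarrow> real \<Rightarrow> real ^ 'n \<Rightarrow> real ^ 'n \<Rightarrow> real" where
  "full_eval_beta F f c \<beta>bar \<gamma> \<tau> x a g p =
     (let d = proj_step F x p;
          \<beta> = (\<lambda>j::nat. \<tau> ^ j * \<beta>bar)
      in \<beta> (LEAST j. f (x + \<beta> j *\<^sub>R d) \<le> f x + c * \<beta> j * (g \<bullet> d) \<or> \<not> \<beta> j \<ge> \<gamma> * a))"

definition full_eval_success ::
  "(real ^ 'n) set \<Rightarrow> (real ^ 'n \<Rightarrow> real) \<Rightarrow> real \<Rightarrow> real \<Rightarrow> real \<Rightarrow> real \<Rightarrow>
   real ^ 'n \<Rightarrow> real \<Rightarrow> real ^ 'n \<Rightarrow> real ^ 'n \<Rightarrow> bool" where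
  "full_eval_success F f c \<beta>bar \<gamma> \<tau> x a g p \<longleftrightarrow> full_eval_beta F f c \<beta>bar \<gamma> \<tau> x a g p \<ge> \<gamma> * a"

definition full_eval_iteration ::
  "(real ^ 'n) set \<Rightarrow> (real ^ 'n \<Rightarrow> real) \<Rightarrow> real \<Rightarrow> real \<Rightarrow> real \<Rightarrow> real \<Rightarrow>
   real ^ 'n \<Rightarrow> real \<Rightarrow> real ^ 'n \<Rightarrow> real ^ 'n \<Rightarrow>
   real ^ 'n \<Rightarrow> real \<Rightarrow> iter_type \<Rightarrow> bool" where
  "full_eval_iteration F f c \<beta>bar \<gamma> \<tau> x a g p x' a' t' \<longleftrightarrow>
     a' = a \<and>
     (if full_eval_success F f c \<beta>bar \<gamma> \<tau> x a g p
      then x' = x + full_eval_beta F f c \<beta>bar \<gamma> \<tau> x a g p *\<^sub>R proj_step F x p \<and> t' = Full_Eval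
      else x' = x \<and> t' = Low_Eval)"

text \<open>When several polling directions are acceptable, any of them may be taken.\<close>

definition low_eval_iteration ::
  "(real ^ 'n) set \<Rightarrow> (real ^ 'n \<Rightarrow> real) \<Rightarrow> real \<Rightarrow> real \<Rightarrow> (real \<Rightarrow> real) \<Rightarrow>
   real ^ 'n \<Rightarrow> real \<Rightarrow> (real ^ 'n) set \<Rightarrow> real ^ 'n \<Rightarrow> real \<Rightarrow> bool" where
  "low_eval_iteration F f lam \<theta> \<rho> x a D x' a' \<longleftrightarrow>
     finite D \<and> 0 \<notin> D \<and>
     (let good = {d \<in> D. x + a *\<^sub>R d \<in> F \<and> f (x + a *\<^sub>R d) \<le> f x - \<rho> a}
      in if good \<noteq> {} then (\<exists>d\<in>good. x' = x + a *\<^sub>R d) \<and> a' = lam * a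
         else x' = x \<and> a' = \<theta> * a)"

text \<open>
  \<open>x\<close>, \<open>\<alpha>\<close>, \<open>t\<close> are the iterates, step sizes and iteration types of a run; \<open>g k\<close>, \<open>p k\<close> are
  meaningful only at Full-Eval iterations \<open>k\<close> and \<open>D k\<close> only at Low-Eval iterations.  The
  user-defined switching condition leaves \<open>t (Suc k)\<close> free after a Low-Eval iteration, up to the
  last conjunct.
\<close>

definition full_low_evaluation ::
  "(real ^ 'n) set \<Rightarrow> (real ^ 'n \<Rightarrow> real) \<Rightarrow>
   real \<Rightarrow> real \<Rightarrow> real \<Rightarrow> real \<Rightarrow> real \<Rightarrow> real \<Rightarrow> (real \<Rightarrow> real) \<Rightarrow>
   (nat \<Rightarrow> real ^ 'n) \<Rightarrow> (nat \<Rightarrow> real) \<Rightarrow> (nat \<Rightarrow> iter_type) \<Rightarrow>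
   (nat \<Rightarrow> real ^ 'n) \<Rightarrow> (nat \<Rightarrow> real ^ 'n) \<Rightarrow> (nat \<Rightarrow> (real ^ 'n) set) \<Rightarrow> bool" where
  "full_low_evaluation F f c \<beta>bar \<gamma> \<tau> lam \<theta> \<rho> x \<alpha> t g p D \<longleftrightarrow>
     x 0 \<in> F \<and> \<alpha> 0 > 0 \<and> t 0 = Full_Eval \<and>
     (\<forall>k. t k = Full_Eval \<longrightarrow>
        full_eval_iteration F f c \<beta>bar \<gamma> \<tau> (x k) (\<alpha> k) (g k) (p k)
          (x (Suc k)) (\<alpha> (Suc k)) (t (Suc k))) \<and>
     (\<forall>k. t k = Low_Eval \<longrightarrow>
        low_eval_iteration F f lam \<theta> \<rho> (x k) (\<alpha> k) (D k) (x (Suc k)) (\<alpha> (Suc k))) \<and>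
     (\<forall>k. t k = Low_Eval \<longrightarrow> (\<exists>k'>k. t k' = Full_Eval))"

end

theory Submission
  imports Defs
begin

text \<open>
  Every successful Full-Eval iteration before the target accuracy is reached lowers \<open>f\<close> by at least
  \<open>\<epsilon>\<^sup>2 / L1\<close>, and no iteration of either type raises \<open>f\<close>.  As \<open>f\<close> starts at \<open>f (x 0)\<close> and stays above
  \<open>f_low\<close>, there are at most \<open>L1 (f (x 0) - f_low) / \<epsilon>\<^sup>2\<close> such iterations
  (lemma \<open>card_drops_times_size_le\<close>).

  The decrease accepted by the line search is \<open>c \<beta>\<^sub>k (-g\<^sub>k) \<bullet> q\<^sub>k\<^sup>p\<close>, and it is bounded below by three
  estimates.  The angle condition and \<open>\<parallel>q\<^sub>k\<^sup>g\<parallel> \<le> U_p \<parallel>q\<^sub>k\<^sup>p\<parallel>\<close> give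
  \<open>(-g\<^sub>k) \<bullet> q\<^sub>k\<^sup>p \<ge> \<kappa> \<parallel>q\<^sub>k\<^sup>g\<parallel>\<^sup>2 / U_p\<close>.  Projection onto the polyhedron is nonexpansive, so the true
  stationarity measure satisfies \<open>\<epsilon> < \<parallel>q\<^sub>k\<parallel> \<le> (1 + u_g) \<parallel>q\<^sub>k\<^sup>g\<parallel>\<close>.  Finally the accepted \<open>\<beta>\<^sub>k\<close> cannot
  be small (lemma \<open>backtracking_step_lower_bound\<close>): either it is the initial trial \<open>\<beta>bar\<close>, or the trial
  \<open>\<beta>\<^sub>k / \<tau>\<close> was rejected, and the quadratic upper model of \<open>f\<close> shows that short steps along a descent
  direction with an accurate gradient are never rejected.
\<close>

section \<open>Projection onto the feasible polyhedron\<close>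

lemma closed_feasible_set: "closed (feasible_set m A b mI AI l u)"
  unfolding feasible_set_def
  by (intro closed_Collect_conj closed_Collect_all closed_Collect_imp closed_Collect_eq
      closed_Collect_le open_Collect_const continuous_intros)

lemma convex_feasible_set:
  fixes A AI :: "nat \<Rightarrow> real ^ 'n"
  shows "convex (feasible_set m A b mI AI l u)"
proof -
  let ?E = "\<lambda>i. {x. i < m \<longrightarrow> A i \<bullet> x = b i}"
  let ?I = "\<lambda>i. {x. i < mI \<longrightarrow> l i \<le> ereal (AI i \<bullet> x) \<and> ereal (AI i \<bullet> x) \<le> u i}"
  have "convex (?E i)" for i
    by (cases "i < m") (auto simp: convex_hyperplane)
  moreover have "convex (?I i)" for i
  proof (cases "i < mI")
    case True
    \<comment> \<open>A bound in \<open>ereal\<close> cuts out a real half-space, everything or nothing.\<close>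
    have "convex {x. l i \<le> ereal (AI i \<bullet> x)}"
      by (cases "l i") (auto simp: convex_halfspace_ge)
    moreover have "convex {x. ereal (AI i \<bullet> x) \<le> u i}"
      by (cases "u i") (auto simp: convex_halfspace_le)
    ultimately have "convex ({x. l i \<le> ereal (AI i \<bullet> x)} \<inter> {x. ereal (AI i \<bullet> x) \<le> u i})"
      by (rule convex_Int)
    also have "\<dots> = ?I i" using True by auto
    finally show ?thesis .
  qed simp
  ultimately have "convex ((\<Inter>i. ?E i) \<inter> (\<Inter>i. ?I i))"
    by (intro convex_Int convex_INT)
  also have "(\<Inter>i. ?E i) \<inter> (\<Inter>i. ?I i) = feasible_set m A b mI AI l u"
    by (auto simp: feasible_set_def)
  finally show ?thesis .
qed

lemma norm_proj_step_diff_le: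
  assumes "convex F" "closed F" "F \<noteq> {}"
  shows "norm (proj_step F x v - proj_step F x w) \<le> norm (v - w)"
  using closest_point_lipschitz[OF assms, of "x + v" "x + w"]
  by (simp add: proj_step_def dist_norm)

section \<open>The backtracking line search\<close>

text \<open>
  The quadratic upper model of a function with Lipschitz gradient: along the segment, \<open>f\<close> minus the
  model has a nonpositive derivative by the Cauchy-Schwarz inequality and the Lipschitz bound.
\<close>

lemma lipschitz_gradient_upper_model:
  fixes f :: "'a::real_inner \<Rightarrow> real"
  assumes grad: "\<And>y. GDERIV f y :> gradf y"
    and lip: "L-lipschitz_on UNIV gradf"
    and s: "0 \<le> s"
  shows "f (x + s *\<^sub>R d) \<le> f x + s * (gradf x \<bullet> d) + L / 2 * s\<^sup>2 * (norm d)\<^sup>2"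
proof -
  let ?h = "\<lambda>r. f (x + r *\<^sub>R d) - r * (gradf x \<bullet> d) - L / 2 * r\<^sup>2 * (norm d)\<^sup>2"
  have "?h s \<le> ?h 0"
  proof (rule DERIV_nonpos_imp_nonincreasing[OF s])
    fix r :: real assume r: "0 \<le> r"
    have "((\<lambda>r. f (x + r *\<^sub>R d)) has_derivative (\<lambda>h. (h *\<^sub>R d) \<bullet> gradf (x + r *\<^sub>R d))) (at r)"
      by (rule has_derivative_compose[where f = "\<lambda>r. x + r *\<^sub>R d" and f' = "\<lambda>h. h *\<^sub>R d"
            and g = f, OF _ grad[unfolded gderiv_def]])
        (auto intro!: derivative_eq_intros)
    hence "((\<lambda>r. f (x + r *\<^sub>R d)) has_real_derivative gradf (x + r *\<^sub>R d) \<bullet> d) (at r)"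
      by (simp add: has_field_derivative_def inner_commute mult_commute_abs)
    hence "(?h has_real_derivative
        gradf (x + r *\<^sub>R d) \<bullet> d - gradf x \<bullet> d - L * r * (norm d)\<^sup>2) (at r)"
      by (auto intro!: derivative_eq_intros)
    moreover have "gradf (x + r *\<^sub>R d) \<bullet> d - gradf x \<bullet> d - L * r * (norm d)\<^sup>2 \<le> 0"
    proof -
      have "gradf (x + r *\<^sub>R d) \<bullet> d - gradf x \<bullet> d \<le> norm (gradf (x + r *\<^sub>R d) - gradf x) * norm d"
        by (metis inner_diff_left norm_cauchy_schwarz)
      also have "\<dots> \<le> (L * norm (r *\<^sub>R d)) * norm d"
        using lipschitz_onD[OF lip, of "x + r *\<^sub>R d" x]
        by (intro mult_right_mono) (auto simp: dist_norm)
      finally show ?thesis using r by (simp add: power2_eq_square mult.assoc)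
    qed
    ultimately show "\<exists>y. (?h has_real_derivative y) (at r) \<and> y \<le> 0" by blast
  qed
  thus ?thesis by simp
qed

text \<open>
  Short steps pass the decrease test: if the test fails at \<open>s\<close>, the upper model makes the second-order
  term \<open>L s \<parallel>d\<parallel>\<^sup>2 / 2\<close> outweigh what remains of the slope, \<open>(\<kappa> (1 - c) - u) G \<parallel>d\<parallel>\<close>, once the
  gradient error \<open>u G\<close> is paid for.  Here \<open>G\<close> stands for the scale \<open>\<parallel>q\<^sub>k\<^sup>g\<parallel>\<close> of the problem.
\<close>

lemma rejected_step_lower_bound:
  fixes f :: "'a::real_inner \<Rightarrow> real"
  assumes grad: "\<And>y. GDERIV f y :> gradf y"
    and L: "L > 0" and lip: "L-lipschitz_on UNIV gradf"
    and s: "0 < s" and c: "c < 1" and d: "d \<noteq> 0"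
    and slope: "\<kappa> * G * norm d \<le> - (g \<bullet> d)"
    and err: "norm (gradf x - g) \<le> u * G"
    and u: "u < \<kappa> * (1 - c)"
    and G: "u_p * norm d \<le> G"
    and rejected: "f (x + s *\<^sub>R d) > f x + c * s * (g \<bullet> d)"
  shows "2 * (\<kappa> * (1 - c) - u) * u_p / L < s"
proof -
  have "s * (c * (g \<bullet> d)) < s * (gradf x \<bullet> d + L / 2 * s * (norm d)\<^sup>2)"
    using rejected lipschitz_gradient_upper_model[OF grad lip less_imp_le[OF s], of x d]
    by (simp add: algebra_simps power2_eq_square)
  hence "c * (g \<bullet> d) < gradf x \<bullet> d + L / 2 * s * (norm d)\<^sup>2"
    using s by (simp only: mult_less_cancel_left_pos)
  hence "0 < (1 - c) * (g \<bullet> d) + (gradf x - g) \<bullet> d + L / 2 * s * (norm d)\<^sup>2"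
    by (simp add: inner_diff_left algebra_simps)
  moreover have "(gradf x - g) \<bullet> d \<le> u * G * norm d"
    using norm_cauchy_schwarz[of "gradf x - g" d] mult_right_mono[OF err norm_ge_zero[of d]]
    by linarith
  moreover have "(1 - c) * (g \<bullet> d) \<le> - ((1 - c) * (\<kappa> * G * norm d))"
    using mult_left_mono[OF slope, of "1 - c"] c by simp
  ultimately have "norm d * ((\<kappa> * (1 - c) - u) * G) < norm d * (L / 2 * s * norm d)"
    by (simp add: algebra_simps power2_eq_square)
  hence "(\<kappa> * (1 - c) - u) * G < L / 2 * s * norm d" using d by simp
  moreover have "(\<kappa> * (1 - c) - u) * (u_p * norm d) \<le> (\<kappa> * (1 - c) - u) * G"
    using G u by (intro mult_left_mono) auto
  ultimately have "norm d * ((\<kappa> * (1 - c) - u) * u_p) < norm d * (L / 2 * s)"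
    by (simp add: algebra_simps)
  hence "(\<kappa> * (1 - c) - u) * u_p < L / 2 * s" using d by simp
  thus ?thesis using L by (simp add: field_simps)
qed

text \<open>
  The search stops because \<open>\<tau>\<^sup>j \<beta>bar\<close> tends to \<open>0\<close> and drops below \<open>\<gamma> a\<close>.  Unless it stops at once,
  the previous trial \<open>r\<close> met the threshold and was rejected.
\<close>

lemma full_eval_beta_cases:
  assumes \<beta>bar: "0 < \<beta>bar" and \<tau>: "0 < \<tau>" "\<tau> < 1" and a: "0 < \<gamma> * a"
    and success: "full_eval_success F f c \<beta>bar \<gamma> \<tau> x a g p"
  defines "d \<equiv> proj_step F x p" and "\<beta> \<equiv> full_eval_beta F f c \<beta>bar \<gamma> \<tau> x a g p"
  shows "f (x + \<beta> *\<^sub>R d) \<le> f x + c * \<beta> * (g \<bullet> d)"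
    and "\<beta> = \<beta>bar \<or> (\<exists>r>0. \<beta> = \<tau> * r \<and> f (x + r *\<^sub>R d) > f x + c * r * (g \<bullet> d))"
proof -
  define B where "B = (\<lambda>j::nat. \<tau> ^ j * \<beta>bar)"
  define P where "P = (\<lambda>j. f (x + B j *\<^sub>R d) \<le> f x + c * B j * (g \<bullet> d) \<or> \<not> B j \<ge> \<gamma> * a)"
  define J where "J = (LEAST j. P j)"
  have \<beta>: "\<beta> = B J"
    by (simp add: \<beta>_def full_eval_beta_def Let_def J_def P_def B_def d_def)
  obtain j where "\<tau> ^ j < \<gamma> * a / \<beta>bar"
    using real_arch_pow_inv[of "\<gamma> * a / \<beta>bar" \<tau>] \<beta>bar \<tau> a by auto
  hence "P j" using \<beta>bar by (simp add: P_def B_def field_simps)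
  hence "P J" unfolding J_def by (rule LeastI)
  moreover have "B J \<ge> \<gamma> * a"
    using success \<beta> by (simp add: full_eval_success_def \<beta>_def)
  ultimately show "f (x + \<beta> *\<^sub>R d) \<le> f x + c * \<beta> * (g \<bullet> d)"
    by (simp add: P_def \<beta>)
  show "\<beta> = \<beta>bar \<or> (\<exists>r>0. \<beta> = \<tau> * r \<and> f (x + r *\<^sub>R d) > f x + c * r * (g \<bullet> d))"
  proof (cases J)
    case 0
    thus ?thesis by (simp add: \<beta> B_def)
  next
    case (Suc i)
    hence "\<not> P i" unfolding J_def using not_less_Least[of i P] by simp
    moreover have "B i > 0" "\<beta> = \<tau> * B i" using \<beta>bar \<tau> by (auto simp: \<beta> Suc B_def)
    ultimately show ?thesis by (auto simp: P_def not_le)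
  qed
qed

lemma backtracking_step_lower_bound:
  fixes f :: "real ^ 'n \<Rightarrow> real"
  assumes grad: "\<And>y. GDERIV f y :> gradf y"
    and L: "L > 0" and lip: "L-lipschitz_on UNIV gradf"
    and \<beta>bar: "0 < \<beta>bar" and \<tau>: "0 < \<tau>" "\<tau> < 1" and a: "0 < \<gamma> * a" and c: "c < 1"
    and success: "full_eval_success F f c \<beta>bar \<gamma> \<tau> x a g p"
    and d: "proj_step F x p \<noteq> 0"
    and slope: "\<kappa> * G * norm (proj_step F x p) \<le> - (g \<bullet> proj_step F x p)"
    and err: "norm (gradf x - g) \<le> u * G"
    and u: "u < \<kappa> * (1 - c)"
    and G: "u_p * norm (proj_step F x p) \<le> G"
  shows "min \<beta>bar (2 * \<tau> * (\<kappa> * (1 - c) - u) * u_p / L) \<le> full_eval_beta F f c \<beta>bar \<gamma> \<tau> x a g p"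
  using full_eval_beta_cases(2)[OF \<beta>bar \<tau> a success]
proof (elim disjE exE conjE)
  fix r
  assume r: "0 < r" "full_eval_beta F f c \<beta>bar \<gamma> \<tau> x a g p = \<tau> * r"
    and rejected: "f (x + r *\<^sub>R proj_step F x p) > f x + c * r * (g \<bullet> proj_step F x p)"
  have "2 * (\<kappa> * (1 - c) - u) * u_p / L < r"
    by (rule rejected_step_lower_bound[OF grad L lip r(1) c d slope err u G rejected])
  hence "\<tau> * (2 * (\<kappa> * (1 - c) - u) * u_p / L) \<le> \<tau> * r"
    using \<tau> by (intro mult_left_mono) auto
  thus ?thesis using r(2) by (simp add: min_le_iff_disj mult.assoc mult.left_commute)
qed simp

section \<open>Decrease along a run\<close>

text \<open>
  Positive step sizes are what makes the line search terminate, its threshold being \<open>\<gamma> \<alpha>\<^sub>k\<close>, and a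
  Low-Eval success a decrease, by \<open>\<rho> (\<alpha>\<^sub>k)\<close>.
\<close>

lemma step_size_pos:
  assumes run: "full_low_evaluation F f c \<beta>bar \<gamma> \<tau> lam \<theta> \<rho> x \<alpha> t g p D"
    and lam: "lam \<ge> 1" and \<theta>: "0 < \<theta>"
  shows "\<alpha> k > 0"
proof (induction k)
  case 0
  show ?case using run by (simp add: full_low_evaluation_def)
next
  case (Suc k)
  show ?case
  proof (cases "t k")
    case Full_Eval
    thus ?thesis using run Suc by (simp add: full_low_evaluation_def full_eval_iteration_def)
  next
    case Low_Eval
    hence "low_eval_iteration F f lam \<theta> \<rho> (x k) (\<alpha> k) (D k) (x (Suc k)) (\<alpha> (Suc k))"
      using run by (simp add: full_low_evaluation_def)
    hence "\<alpha> (Suc k) = lam * \<alpha> k \<or> \<alpha> (Suc k) = \<theta> * \<alpha> k"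
      by (auto simp: low_eval_iteration_def Let_def split: if_splits)
    thus ?thesis using Suc lam \<theta> by auto
  qed
qed

lemma low_eval_iteration_nonincreasing:
  assumes "low_eval_iteration F f lam \<theta> \<rho> x a D x' a'" "\<rho> a > 0"
  shows "f x' \<le> f x"
  using assms by (auto simp: low_eval_iteration_def Let_def split: if_splits)

lemma card_drops_times_size_le:
  fixes \<phi> :: "nat \<Rightarrow> real"
  assumes mono: "\<And>k. k \<le> K \<Longrightarrow> \<phi> (Suc k) \<le> \<phi> k"
    and drop: "\<And>k. k \<le> K \<Longrightarrow> S k \<Longrightarrow> \<phi> (Suc k) \<le> \<phi> k - \<delta>"
  shows "real (card {k. k \<le> K \<and> S k}) * \<delta> \<le> \<phi> 0 - \<phi> (Suc K)"
proof -
  have "real (card {k. k \<le> K \<and> S k}) * \<delta> = (\<Sum>k | k \<le> K \<and> S k. \<delta>)" by simp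
  also have "\<dots> \<le> (\<Sum>k | k \<le> K \<and> S k. \<phi> k - \<phi> (Suc k))"
    using drop by (intro sum_mono) force
  also have "\<dots> \<le> (\<Sum>k\<le>K. \<phi> k - \<phi> (Suc k))"
    using mono by (intro sum_mono2) auto
  also have "\<dots> = \<phi> 0 - \<phi> (Suc K)" by (rule sum_telescope)
  finally show ?thesis .
qed

theorem theorem4p1:
  fixes f :: "real ^ 'n \<Rightarrow> real"
    and gradf :: "real ^ 'n \<Rightarrow> real ^ 'n"
    and F :: "(real ^ 'n) set"
    and m mI :: nat
    and A AI :: "nat \<Rightarrow> real ^ 'n"
    and b :: "nat \<Rightarrow> real"
    and l u :: "nat \<Rightarrow> ereal"
    and c \<beta>bar \<gamma> \<tau> lam \<theta> :: real
    and \<rho> :: "real \<Rightarrow> real"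
    and x g p :: "nat \<Rightarrow> real ^ 'n"
    and \<alpha> :: "nat \<Rightarrow> real"
    and t :: "nat \<Rightarrow> iter_type"
    and D :: "nat \<Rightarrow> (real ^ 'n) set"
    and f_low L \<kappa> u_p U_p u_g \<epsilon> :: real
    and K :: nat
  assumes rank: "full_row_rank m A"
    and bounds: "\<forall>i<mI. l i < u i"
    and F: "F = feasible_set m A b mI AI l u" "F \<noteq> {}"
    and c: "0 < c" "c < 1"
    and \<beta>bar: "0 < \<beta>bar" "\<beta>bar \<le> 1"
    and \<gamma>: "\<gamma> > 0"
    and \<tau>: "0 < \<tau>" "\<tau> < 1"
    and lam: "lam \<ge> 1"
    and \<theta>: "0 < \<theta>" "\<theta> < 1"
    and \<rho>: "\<forall>a>0. \<rho> a > 0"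
    and run: "full_low_evaluation F f c \<beta>bar \<gamma> \<tau> lam \<theta> \<rho> x \<alpha> t g p D"
    and i: "\<forall>y. f y \<ge> f_low"
    and ii: "\<forall>y. GDERIV f y :> gradf y" "continuous_on UNIV gradf"
      "L > 0" "L-lipschitz_on UNIV gradf"
    and iii_const: "0 < \<kappa>" "\<kappa> \<le> 1" "u_p > 0" "U_p > 0"
    and iii: "\<forall>k. t k = Full_Eval \<longrightarrow>
      (let qg = proj_step F (x k) (- g k); qp = proj_step F (x k) (p k)
       in qg \<noteq> 0 \<and> qp \<noteq> 0 \<and>
          (- g k) \<bullet> qp / (norm qg * norm qp) \<ge> \<kappa> \<and>
          u_p * norm qp \<le> norm qg \<and> norm qg \<le> U_p * norm qp)"
    and iv_const: "0 < u_g" "u_g < \<kappa> * (1 - c)"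
    and iv: "\<forall>k. t k = Full_Eval \<longrightarrow>
      norm (gradf (x k) - g k) \<le> u_g * norm (proj_step F (x k) (- g k))"
    and \<epsilon>: "\<epsilon> > 0"
    and K: "K \<ge> 1"
      "norm (proj_step F (x (K + 1)) (- gradf (x (K + 1)))) \<le> \<epsilon>"
      "\<forall>k\<le>K. norm (proj_step F (x k) (- gradf (x k))) > \<epsilon>"
  shows "let \<beta>_min = min \<beta>bar (2 * \<tau> * (\<kappa> * (1 - c) - u_g) * u_p / L);
             L1 = (u_g + 1)\<^sup>2 * U_p / (c * \<kappa> * \<beta>_min);
             n_SF = card {k. k \<le> K \<and> t k = Full_Eval \<and>
                             full_eval_success F f c \<beta>bar \<gamma> \<tau> (x k) (\<alpha> k) (g k) (p k)}
         in int n_SF \<le> \<lceil>L1 * (f (x 0) - f_low) * \<epsilon> powi (- 2)\<rceil>"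
proof -
  define \<beta>m where "\<beta>m = min \<beta>bar (2 * \<tau> * (\<kappa> * (1 - c) - u_g) * u_p / L)"
  define L1 where "L1 = (u_g + 1)\<^sup>2 * U_p / (c * \<kappa> * \<beta>m)"
  define S where "S = (\<lambda>k. t k = Full_Eval \<and>
    full_eval_success F f c \<beta>bar \<gamma> \<tau> (x k) (\<alpha> k) (g k) (p k))"
  have \<beta>m: "\<beta>m > 0" using \<beta>bar \<tau> iii_const iv_const ii(3) by (simp add: \<beta>m_def)
  have L1: "L1 > 0" using \<beta>m iii_const iv_const c by (simp add: L1_def)
  have F': "convex F" "closed F" by (simp_all add: F(1) convex_feasible_set closed_feasible_set)
  have \<alpha>: "\<alpha> k > 0" for k by (rule step_size_pos[OF run lam \<theta>(1)])
  have full: "full_eval_iteration F f c \<beta>bar \<gamma> \<tau> (x k) (\<alpha> k) (g k) (p k)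
      (x (Suc k)) (\<alpha> (Suc k)) (t (Suc k))" if "t k = Full_Eval" for k
    using run that by (simp add: full_low_evaluation_def)

  have drop: "f (x (Suc k)) \<le> f (x k) - \<epsilon>\<^sup>2 / L1" if k: "k \<le> K" and S: "S k" for k
  proof -
    let ?q = "proj_step F (x k) (- gradf (x k))"
    let ?qg = "proj_step F (x k) (- g k)" and ?qp = "proj_step F (x k) (p k)"
    let ?\<beta> = "full_eval_beta F f c \<beta>bar \<gamma> \<tau> (x k) (\<alpha> k) (g k) (p k)"
    have tk: "t k = Full_Eval" and success: "full_eval_success F f c \<beta>bar \<gamma> \<tau> (x k) (\<alpha> k) (g k) (p k)"
      using S by (auto simp: S_def)
    have ne: "?qg \<noteq> 0" "?qp \<noteq> 0" and angle: "\<kappa> \<le> (- g k) \<bullet> ?qp / (norm ?qg * norm ?qp)"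
      and len: "u_p * norm ?qp \<le> norm ?qg" "norm ?qg \<le> U_p * norm ?qp"
      using iii tk by (auto simp: Let_def)
    have slope: "\<kappa> * norm ?qg * norm ?qp \<le> - (g k \<bullet> ?qp)"
    proof -
      have "0 < norm ?qg * norm ?qp" using ne by simp
      from angle[unfolded pos_le_divide_eq[OF this]] show ?thesis by (simp add: mult.assoc)
    qed
    have err: "norm (gradf (x k) - g k) \<le> u_g * norm ?qg" using iv tk by blast
    have \<gamma>\<alpha>: "0 < \<gamma> * \<alpha> k" using \<gamma> \<alpha> by simp
    have \<beta>: "\<beta>m \<le> ?\<beta>"
      unfolding \<beta>m_def
      by (rule backtracking_step_lower_bound[OF ii(1)[rule_format] ii(3,4) \<beta>bar(1) \<tau> \<gamma>\<alpha> c(2)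
            success ne(2) slope err iv_const(2) len(1)])

    have "norm (?q - ?qg) \<le> norm (gradf (x k) - g k)"
      using norm_proj_step_diff_le[OF F' F(2), of "x k" "- gradf (x k)" "- g k"]
      by (simp add: norm_minus_commute)
    hence "norm ?q \<le> (u_g + 1) * norm ?qg"
      using err norm_triangle_ineq2[of ?q ?qg] by (simp add: algebra_simps)
    hence "\<epsilon> \<le> (u_g + 1) * norm ?qg" using K(3) k by force
    hence "\<epsilon>\<^sup>2 \<le> (u_g + 1)\<^sup>2 * (norm ?qg)\<^sup>2"
      using power_mono[of \<epsilon> _ 2] \<epsilon> by (metis less_imp_le power_mult_distrib)
    also have "(norm ?qg)\<^sup>2 \<le> U_p * (norm ?qg * norm ?qp)"
      using mult_left_mono[OF len(2) norm_ge_zero[of ?qg]]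
      by (simp add: power2_eq_square algebra_simps)
    finally have "\<epsilon>\<^sup>2 \<le> (u_g + 1)\<^sup>2 * (U_p * (norm ?qg * norm ?qp))"
      by (simp add: mult_left_mono)
    hence "\<epsilon>\<^sup>2 / L1 \<le> (u_g + 1)\<^sup>2 * (U_p * (norm ?qg * norm ?qp)) / L1"
      using L1 by (simp add: divide_right_mono)
    also have "\<dots> = c * \<beta>m * (\<kappa> * norm ?qg * norm ?qp)"
      using \<beta>m c iii_const iv_const by (simp add: L1_def field_simps)
    also have "\<dots> \<le> c * ?\<beta> * - (g k \<bullet> ?qp)"
      using \<beta> slope \<beta>m c iii_const by (intro mult_mono) auto
    finally have "\<epsilon>\<^sup>2 / L1 \<le> - (c * ?\<beta> * (g k \<bullet> ?qp))" by simp
    moreover have "x (Suc k) = x k + ?\<beta> *\<^sub>R ?qp"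
      using full[OF tk] success by (simp add: full_eval_iteration_def)
    ultimately show ?thesis
      using full_eval_beta_cases(1)[OF \<beta>bar(1) \<tau> \<gamma>\<alpha> success] by simp
  qed

  have mono: "f (x (Suc k)) \<le> f (x k)" if k: "k \<le> K" for k
  proof (cases "t k")
    case Low_Eval
    thus ?thesis using run \<rho> \<alpha>
      by (auto simp: full_low_evaluation_def intro: low_eval_iteration_nonincreasing)
  next
    case Full_Eval
    show ?thesis
    proof (cases "S k")
      case True
      thus ?thesis using drop[OF k] L1 by (smt (verit) divide_nonneg_pos zero_le_power2)
    next
      case False
      thus ?thesis using full[OF Full_Eval] Full_Eval by (simp add: S_def full_eval_iteration_def)
    qed
  qed

  have "real (card {k. k \<le> K \<and> S k}) * (\<epsilon>\<^sup>2 / L1) \<le> f (x 0) - f (x (Suc K))"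
    by (rule card_drops_times_size_le[where \<phi> = "\<lambda>k. f (x k)", OF mono drop])
  also have "\<dots> \<le> f (x 0) - f_low" using i by simp
  finally have "real (card {k. k \<le> K \<and> S k}) \<le> L1 * (f (x 0) - f_low) * \<epsilon> powi (- 2)"
    using L1 \<epsilon> by (simp add: power_int_minus field_simps)
  hence "int (card {k. k \<le> K \<and> S k}) \<le> \<lceil>L1 * (f (x 0) - f_low) * \<epsilon> powi (- 2)\<rceil>"
    by (simp add: le_ceiling_iff)
  thus ?thesis by (simp add: Let_def S_def L1_def \<beta>m_def)
qed

end
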